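(* Let $G$ be a sandpile graph with nonsink vertices $1,\dots,n$. The toppling ideal $I(G)\subseteq\mathbb{C}[x_1,\dots,x_n]$ is generated by the toppling polynomials $\{t_i\}_{i=1}^n$ and the polynomial $x^b-1$, where $b$ is any burning configuration on $G$.
   Context: A directed multigraph $G=(V,E)$ has a finite vertex set $V$ and edge set $E\subseteq V\times V$ with a weight function $\mathrm{wt}:V\times V\to\mathbb{N}$, $\mathrm{wt}(u,v)>0$ iff $(u,v)\in E$ (loops allowed); $\mathrm{outdeg}(v)=\sum_{u\in V}\mathrm{wt}(v,u)$. A sandpile graph $(V,E,s)$ is a directed multigraph with a vertex $s$ (the sink) that is globally accessible: from every vertex there is a directed path to $s$. The sink may have outgoing edges. Identify $V$ with $\{1,\dots,n+1\}$, $n+1$ being the sink, and let $\widetilde V=\{1,\dots,n\}$. The reduced Laplacian is $\widetilde\Delta:\mathbb{Z}\widetilde V\to\mathbb{Z}\widetilde V$, $\widetilde\Delta(v)=\mathrm{outdeg}(v)\,v-\sum_{u\in\widetilde V}\mathrm{wt}(v,u)\,u$; $\widetilde{\mathcal{L}}=\mathrm{im}(\widetilde\Delta)$. The toppling ideal is $I(G)=\mathrm{Span}_{\mathbb{C}}\{x^u-x^v:u,v\in\mathbb{N}^n,\ u-v\in\widetilde{\mathcal{L}}\}\subseteq\mathbb{C}[x_1,\dots,x_n]$, where $x^u=\prod_i x_i^{u_i}$. For each nonsink vertex $i$, the toppling polynomial is $t_i=x_i^{\mathrm{outdeg}(i)-\mathrm{wt}(i,i)}-\prod_{1\le j\le n,\,j\ne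 i}x_j^{\mathrm{wt}(i,j)}$. A burning configuration is $b\in\mathbb{Z}\widetilde V$ such that (1) $b\in\widetilde{\mathcal{L}}$; (2) $b\ge 0$ coordinatewise; (3) for every $v\in\widetilde V$ there exists a (directed) path in $G$ to $v$ from some element of $\mathrm{supp}(b)=\{u\in\widetilde V:b_u\ne0\}$.
   Formalization: In condition (3) of a burning configuration the directed paths from supp(b) are required to pass only through nonsink vertices; if the sink has outgoing edges and paths may pass through it, the claim can fail (edges 1→4, 4→2, 2→3, 2→4, 3→2, sink 4, b = e_1). *)

theory Defs
  imports Complex_Main "HOL-Library.Poly_Mapping" "HOL-Algebra.Ideal"
    "HOL-Algebra.Free_Abelian_Groups"
begin

section \<open>Sandpile graphs\<close>

definition directed_multigraph ::
  "'v set \<Rightarrow> ('v \<times> 'v) set \<Rightarrow> ('v \<Rightarrow> 'v \<Rightarrow> nat) \<Rightarrow> bool" where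
  "directed_multigraph V E wt \<longleftrightarrow>
     finite V \<and> E \<subseteq> V \<times> V \<and> (\<forall>u\<in>V. \<forall>v\<in>V. wt u v > 0 \<longleftrightarrow> (u, v) \<in> E)"

definition sandpile_graph ::
  "'v set \<Rightarrow> ('v \<times> 'v) set \<Rightarrow> ('v \<Rightarrow> 'v \<Rightarrow> nat) \<Rightarrow> 'v \<Rightarrow> bool" where
  "sandpile_graph V E wt s \<longleftrightarrow>
     directed_multigraph V E wt \<and> s \<in> V \<and> (\<forall>v\<in>V. (v, s) \<in> E\<^sup>*)"

definition outdeg :: "'v set \<Rightarrow> ('v \<Rightarrow> 'v \<Rightarrow> nat) \<Rightarrow> 'v \<Rightarrow> nat" where
  "outdeg V wt v = (\<Sum>u\<in>V. wt v u)"

text \<open>The free abelian group on a set \<open>X\<close> of vertices is \<^const>\<open>free_Abelian_group\<close>;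
  its elements are the finitely supported integer functions with support in \<open>X\<close>, a vertex \<open>v\<close>
  being \<open>frag_of v\<close>. The reduced Laplacian is the \<open>\<int>\<close>-linear extension of its values on the
  nonsink vertices.\<close>

definition reduced_laplacian ::
  "'v set \<Rightarrow> ('v \<Rightarrow> 'v \<Rightarrow> nat) \<Rightarrow> 'v \<Rightarrow> ('v \<Rightarrow>\<^sub>0 int) \<Rightarrow> ('v \<Rightarrow>\<^sub>0 int)" where
  "reduced_laplacian V wt s =
     frag_extend (\<lambda>v. frag_cmul (int (outdeg V wt v)) (frag_of v)
                      - (\<Sum>u\<in>V - {s}. frag_cmul (int (wt v u)) (frag_of u)))"

definition laplacian_lattice ::
  "'v set \<Rightarrow> ('v \<Rightarrow> 'v \<Rightarrow> nat) \<Rightarrow> 'v \<Rightarrow> ('v \<Rightarrow>\<^sub>0 int) set" where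
  "laplacian_lattice V wt s =
     reduced_laplacian V wt s ` carrier (free_Abelian_group (V - {s}))"

text \<open>The nonnegative elements of the free abelian group, i.e. \<open>\<nat>\<^sup>n\<close> inside \<open>\<int>\<^sup>n\<close>.\<close>

definition nonneg_configs :: "'v set \<Rightarrow> ('v \<Rightarrow>\<^sub>0 int) set" where
  "nonneg_configs X =
     {u \<in> carrier (free_Abelian_group X). \<forall>v\<in>X. Poly_Mapping.lookup u v \<ge> 0}"

text \<open>In a burning configuration the paths starting in the support are paths through nonsink
  vertices (\<open>Restr E (V - {s})\<close>); the path of length zero is allowed. If the sink has no outgoing
  edges this is no restriction, see \<open>reachable_avoiding_sink_iff\<close> below. If it does, paths
  through the sink cannot be admitted, because the edges leaving the sink do not affect the
  reduced Laplacian: for the edges \<open>1\<rightarrow>4\<close>, \<open>4\<rightarrow>2\<close>, \<open>2\<rightarrow>3\<close>, \<open>2\<rightarrow>4\<close>, \<open>3\<rightarrow>2\<close> of weight one and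
  sink \<open>4\<close>, the configuration \<open>b = 1\<cdot>v\<^sub>1\<close> would be burning, although \<open>x\<^sub>2 - 1\<close> lies in the toppling
  ideal and \<open>(x\<^sub>1 - 1, x\<^sub>2\<^sup>2 - x\<^sub>3, x\<^sub>3 - x\<^sub>2)\<close> vanishes at \<open>(1, 0, 0)\<close>.\<close>

definition burning_configuration ::
  "'v set \<Rightarrow> ('v \<times> 'v) set \<Rightarrow> ('v \<Rightarrow> 'v \<Rightarrow> nat) \<Rightarrow> 'v \<Rightarrow> ('v \<Rightarrow>\<^sub>0 int) \<Rightarrow> bool" where
  "burning_configuration V E wt s b \<longleftrightarrow>
     b \<in> laplacian_lattice V wt s \<and>
     b \<in> nonneg_configs (V - {s}) \<and>
     (\<forall>v\<in>V - {s}. \<exists>u\<in>Poly_Mapping.keys b. (u, v) \<in> (Restr E (V - {s}))\<^sup>*)"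

lemma reachable_avoiding_sink_iff:
  assumes "E \<subseteq> V \<times> V" and "\<And>v. (s, v) \<notin> E" and "u \<in> V - {s}" and "v \<in> V - {s}"
  shows "(u, v) \<in> (Restr E (V - {s}))\<^sup>* \<longleftrightarrow> (u, v) \<in> E\<^sup>*"
proof
  assume "(u, v) \<in> (Restr E (V - {s}))\<^sup>*"
  then show "(u, v) \<in> E\<^sup>*"
    by (meson inf_le1 rtrancl_mono subsetD)
next
  assume "(u, v) \<in> E\<^sup>*"
  then show "(u, v) \<in> (Restr E (V - {s}))\<^sup>*"
    using assms(3)
  proof (induction rule: converse_rtrancl_induct)
    case (step y z)
    have "z \<noteq> s"
      using step.hyps(2) assms(2,4) by (auto elim: converse_rtranclE)
    then have "(y, z) \<in> Restr E (V - {s})" and "z \<in> V - {s}"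
      using step.hyps(1) step.prems assms(1) by auto
    then show ?case
      using step.IH by (meson converse_rtrancl_into_rtrancl)
  qed simp
qed

section \<open>Polynomials\<close>

type_synonym 'v cpoly = "('v \<Rightarrow>\<^sub>0 nat) \<Rightarrow>\<^sub>0 complex"

definition poly_ring :: "'v set \<Rightarrow> 'v cpoly ring" where
  "poly_ring X =
     \<lparr>carrier = {p. \<forall>m\<in>Poly_Mapping.keys p. Poly_Mapping.keys m \<subseteq> X},
      monoid.mult = (*), monoid.one = 1, ring.zero = 0, ring.add = (+)\<rparr>"

definition pvar :: "'v \<Rightarrow> 'v cpoly" where
  "pvar i = Poly_Mapping.single (Poly_Mapping.single i 1) 1"

definition pscale :: "complex \<Rightarrow> 'v cpoly \<Rightarrow> 'v cpoly" where
  "pscale c p = Poly_Mapping.single 0 c * p"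

text \<open>The monomial \<open>x\<^sup>u\<close>, used only for \<open>u \<in> nonneg_configs X\<close>.\<close>

definition pmonom :: "'v set \<Rightarrow> ('v \<Rightarrow>\<^sub>0 int) \<Rightarrow> 'v cpoly" where
  "pmonom X u = (\<Prod>i\<in>X. pvar i ^ nat (Poly_Mapping.lookup u i))"

text \<open>The locale-based notions \<^const>\<open>genideal\<close> and \<^const>\<open>module.span\<close> have their intended
  meaning only for actual rings and modules.\<close>

lemma cring_poly_ring: "cring (poly_ring X)"
proof (rule cringI)
  show "abelian_group (poly_ring X)"
  proof (rule abelian_groupI)
    fix p assume "p \<in> carrier (poly_ring X)"
    then show "\<exists>q\<in>carrier (poly_ring X). q \<oplus>\<^bsub>poly_ring X\<^esub> p = \<zero>\<^bsub>poly_ring X\<^esub>"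
      by (intro bexI[of _ "- p"])
        (auto simp: poly_ring_def in_keys_iff)
  qed (use keys_add in \<open>fastforce simp: poly_ring_def algebra_simps\<close>)+
  show "comm_monoid (poly_ring X)"
  proof (rule comm_monoidI)
    fix p q assume pq: "p \<in> carrier (poly_ring X)" "q \<in> carrier (poly_ring X)"
    have "Poly_Mapping.keys m \<subseteq> X" if m: "m \<in> Poly_Mapping.keys (p * q)" for m
    proof -
      obtain a b where "m = a + b" "a \<in> Poly_Mapping.keys p" "b \<in> Poly_Mapping.keys q"
        using m keys_mult[of p q] by blast
      then show ?thesis
        using pq keys_add[of a b] by (fastforce simp: poly_ring_def)
    qed
    then show "p \<otimes>\<^bsub>poly_ring X\<^esub> q \<in> carrier (poly_ring X)"
      by (simp add: poly_ring_def)
  qed (auto simp: poly_ring_def algebra_simps)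
qed (auto simp: poly_ring_def algebra_simps)

lemma vector_space_pscale: "vector_space pscale"
  by unfold_locales
    (simp_all add: pscale_def algebra_simps single_add mult_single flip: mult.assoc)

section \<open>The toppling ideal and the toppling polynomials\<close>

definition toppling_ideal ::
  "'v set \<Rightarrow> ('v \<Rightarrow> 'v \<Rightarrow> nat) \<Rightarrow> 'v \<Rightarrow> 'v cpoly set" where
  "toppling_ideal V wt s =
     module.span pscale
       {pmonom (V - {s}) u - pmonom (V - {s}) v | u v.
          u \<in> nonneg_configs (V - {s}) \<and> v \<in> nonneg_configs (V - {s}) \<and>
          u - v \<in> laplacian_lattice V wt s}"

definition toppling_polynomial ::
  "'v set \<Rightarrow> ('v \<Rightarrow> 'v \<Rightarrow> nat) \<Rightarrow> 'v \<Rightarrow> 'v \<Rightarrow> 'v cpoly" where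
  "toppling_polynomial V wt s i =
     pvar i ^ (outdeg V wt i - wt i i) - (\<Prod>j\<in>V - {s} - {i}. pvar j ^ wt i j)"

end

theory Submission
  imports Defs
begin

text \<open>
  The toppling ideal $I$ is spanned by the binomials $x^u - x^v$ whose exponents differ by an element
  of the Laplacian lattice. It is an ideal, since multiplying such a binomial by a monomial shifts
  both exponents by the same vector. The toppling polynomial $t_i$ and $x^b - 1$ are binomials of
  this kind, for the lattice elements $\widetilde\Delta(i)$ and $b$. So the ideal $J$ that they
  generate is contained in $I$.

  For the converse, the point is that all variables are units modulo $J$. As $x^b \equiv 1$, every
  $x_k$ with $k$ in the support of $b$ is a unit, because it divides $x^b$. If $x_i$ is a unit, then
  $t_i$ says that $\prod_{j \neq i} x_j^{\mathrm{wt}(i,j)}$ is congruent to a power of $x_i$, hence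
  a unit as well, and so is every factor of it: being a unit spreads along the edges between nonsink
  vertices. By the definition of a burning configuration it reaches every nonsink vertex
  (\<open>burning_units\<close>).

  Once monomials can be cancelled, the lattice elements $w$ such that $x^u \equiv x^v$ whenever
  $u - v = w$ form a subgroup. It contains each generator $\widetilde\Delta(i)$ because of $t_i$, so
  it is the whole lattice (\<open>lattice_diff_mem\<close>), and therefore $I \subseteq J$.
\<close>

section \<open>Monomials with exponents in the free abelian group\<close>

text \<open>Exponent vectors are integer-valued, whereas multidegrees of polynomials and edge weights are
  natural numbers; the following converts a family of naturals into an exponent vector supported
  on \<open>X\<close>.\<close>

definition nat_config :: "'v set \<Rightarrow> ('v \<Rightarrow> nat) \<Rightarrow> ('v \<Rightarrow>\<^sub>0 int)" where
  "nat_config X f = (\<Sum>i\<in>X. frag_cmul (int (f i)) (frag_of i))"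

lemma lookup_nat_config:
  assumes "finite X"
  shows "Poly_Mapping.lookup (nat_config X f) j = (if j \<in> X then int (f j) else 0)"
proof -
  have "Poly_Mapping.lookup (nat_config X f) j = (\<Sum>i\<in>X. if i = j then int (f i) else 0)"
    unfolding nat_config_def lookup_sum
    by (intro sum.cong) auto
  then show ?thesis
    using assms by simp
qed

lemma nat_config_nonneg:
  assumes "finite X"
  shows "nat_config X f \<in> nonneg_configs X"
proof -
  have "Poly_Mapping.keys (nat_config X f) \<subseteq> X"
    unfolding subset_iff in_keys_iff lookup_nat_config[OF assms] by simp
  then show ?thesis
    by (simp add: nonneg_configs_def lookup_nat_config[OF assms])
qed

lemma nonneg_configs_add:
  assumes "u \<in> nonneg_configs X" and "v \<in> nonneg_configs X"
  shows "u + v \<in> nonneg_configs X"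
  using assms keys_add[of u v] by (auto simp: nonneg_configs_def lookup_add)

text \<open>Adding the negative part of \<open>w\<close> clears its negative entries. This is how monomials can be
  attached to lattice elements of mixed sign.\<close>

lemma ex_nonneg_shift:
  assumes "finite X" and "Poly_Mapping.keys w \<subseteq> X"
  obtains m where "m \<in> nonneg_configs X" and "m + w \<in> nonneg_configs X"
proof -
  let ?m = "nat_config X (\<lambda>i. nat (- Poly_Mapping.lookup w i))"
  have m: "?m \<in> nonneg_configs X"
    using assms(1) by (rule nat_config_nonneg)
  have "Poly_Mapping.keys (?m + w) \<subseteq> X"
    using m assms(2) keys_add[of ?m w] unfolding nonneg_configs_def by fastforce
  moreover have "0 \<le> Poly_Mapping.lookup (?m + w) i" if "i \<in> X" for i
    using that by (simp add: lookup_add lookup_nat_config[OF assms(1)])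
  ultimately have "?m + w \<in> nonneg_configs X"
    by (simp add: nonneg_configs_def)
  with m show thesis
    by (rule that)
qed

lemma pmonom_add:
  assumes "u \<in> nonneg_configs X" and "v \<in> nonneg_configs X"
  shows "pmonom X (u + v) = pmonom X u * pmonom X v"
  unfolding pmonom_def prod.distrib[symmetric]
  using assms
  by (intro prod.cong)
    (auto simp: nonneg_configs_def lookup_add nat_add_distrib power_add)

lemma pmonom_zero: "pmonom X 0 = 1"
  by (simp add: pmonom_def)

lemma pmonom_nat_config:
  assumes "finite X"
  shows "pmonom X (nat_config X f) = (\<Prod>i\<in>X. pvar i ^ f i)"
  unfolding pmonom_def using assms by (intro prod.cong) (auto simp: lookup_nat_config)

lemma pvar_power: "pvar i ^ k = Poly_Mapping.single (Poly_Mapping.single i k) 1"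
  by (induction k) (auto simp: pvar_def mult_single simp flip: single_add)

lemma single_eq_pmonom:
  assumes "finite X" and "Poly_Mapping.keys m \<subseteq> X"
  shows "Poly_Mapping.single m (1 :: complex) = pmonom X (nat_config X (Poly_Mapping.lookup m))"
proof -
  have "(\<Prod>i\<in>A. pvar i ^ f i) =
      Poly_Mapping.single (\<Sum>i\<in>A. Poly_Mapping.single i (f i)) (1 :: complex)"
    if "finite A" for A and f :: "'a \<Rightarrow> nat"
    using that by induction (auto simp: pvar_power mult_single)
  moreover have "(\<Sum>i\<in>X. Poly_Mapping.single i (Poly_Mapping.lookup m i)) = m"
  proof (rule poly_mapping_eqI)
    fix k
    have "Poly_Mapping.lookup (\<Sum>i\<in>X. Poly_Mapping.single i (Poly_Mapping.lookup m i)) k =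
        (if k \<in> X then Poly_Mapping.lookup m k else 0)"
      using assms(1) by (simp add: lookup_sum lookup_single when_def)
    moreover have "k \<notin> X \<Longrightarrow> Poly_Mapping.lookup m k = 0"
      using assms(2) not_in_keys_iff_lookup_eq_zero[of k m] by blast
    ultimately show "Poly_Mapping.lookup (\<Sum>i\<in>X. Poly_Mapping.single i (Poly_Mapping.lookup m i)) k =
        Poly_Mapping.lookup m k"
      by simp
  qed
  ultimately show ?thesis
    using assms(1) by (simp add: pmonom_nat_config)
qed

lemma poly_sum_singles:
  fixes p :: "'a \<Rightarrow>\<^sub>0 'b :: comm_monoid_add"
  shows "p = (\<Sum>m\<in>Poly_Mapping.keys p. Poly_Mapping.single m (Poly_Mapping.lookup p m))"
  by (intro poly_mapping_eqI) (simp add: lookup_sum lookup_single when_def in_keys_iff)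

section \<open>Ideals of the polynomial ring\<close>

lemma poly_ring_simps [simp]:
  "p \<oplus>\<^bsub>poly_ring X\<^esub> q = p + q" "p \<otimes>\<^bsub>poly_ring X\<^esub> q = p * q"
  "\<zero>\<^bsub>poly_ring X\<^esub> = 0" "\<one>\<^bsub>poly_ring X\<^esub> = 1"
  by (simp_all add: poly_ring_def)

lemma poly_ring_closed [intro]:
  shows "0 \<in> carrier (poly_ring X)" and "1 \<in> carrier (poly_ring X)"
    and "p \<in> carrier (poly_ring X) \<Longrightarrow> q \<in> carrier (poly_ring X) \<Longrightarrow> p + q \<in> carrier (poly_ring X)"
    and "p \<in> carrier (poly_ring X) \<Longrightarrow> q \<in> carrier (poly_ring X) \<Longrightarrow> p * q \<in> carrier (poly_ring X)"
    and "p \<in> carrier (poly_ring X) \<Longrightarrow> - p \<in> carrier (poly_ring X)"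
    and "i \<in> X \<Longrightarrow> pvar i \<in> carrier (poly_ring X)"
    and "Poly_Mapping.single 0 c \<in> carrier (poly_ring X)"
proof -
  interpret cring "poly_ring X"
    by (rule cring_poly_ring)
  show "0 \<in> carrier (poly_ring X)" "1 \<in> carrier (poly_ring X)"
    using zero_closed one_closed by simp_all
  show "p \<in> carrier (poly_ring X) \<Longrightarrow> q \<in> carrier (poly_ring X) \<Longrightarrow> p + q \<in> carrier (poly_ring X)"
    using a_closed[of p q] by simp
  show "p \<in> carrier (poly_ring X) \<Longrightarrow> q \<in> carrier (poly_ring X) \<Longrightarrow> p * q \<in> carrier (poly_ring X)"
    using m_closed[of p q] by simp
  show "p \<in> carrier (poly_ring X) \<Longrightarrow> - p \<in> carrier (poly_ring X)"
    by (simp add: poly_ring_def)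
  show "i \<in> X \<Longrightarrow> pvar i \<in> carrier (poly_ring X)"
    by (simp add: poly_ring_def pvar_def)
  show "Poly_Mapping.single 0 c \<in> carrier (poly_ring X)"
    by (simp add: poly_ring_def)
qed

lemma poly_ring_diff_closed [intro]:
  "p \<in> carrier (poly_ring X) \<Longrightarrow> q \<in> carrier (poly_ring X) \<Longrightarrow> p - q \<in> carrier (poly_ring X)"
  using poly_ring_closed(3)[of p X "- q"] poly_ring_closed(5)[of q X] by simp

lemma poly_ring_power_closed [intro]:
  "p \<in> carrier (poly_ring X) \<Longrightarrow> p ^ k \<in> carrier (poly_ring X)"
  by (induction k) auto

lemma poly_ring_prod_closed [intro]:
  "(\<And>i. i \<in> A \<Longrightarrow> f i \<in> carrier (poly_ring X)) \<Longrightarrow> prod f A \<in> carrier (poly_ring X)"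
  by (induction A rule: infinite_finite_induct) auto

lemma pmonom_closed [intro]: "pmonom X u \<in> carrier (poly_ring X)"
  unfolding pmonom_def by auto

lemma ideal_poly_ringI:
  assumes "J \<subseteq> carrier (poly_ring X)" and "0 \<in> J"
    and add: "\<And>p q. p \<in> J \<Longrightarrow> q \<in> J \<Longrightarrow> p + q \<in> J"
    and mult: "\<And>r p. r \<in> carrier (poly_ring X) \<Longrightarrow> p \<in> J \<Longrightarrow> r * p \<in> J"
  shows "ideal J (poly_ring X)"
proof -
  interpret cring "poly_ring X"
    by (rule cring_poly_ring)
  have minus: "\<ominus>\<^bsub>poly_ring X\<^esub> p = - p" if "p \<in> J" for p
    using that assms(1) by (intro minus_equality) auto
  have "- p \<in> J" if "p \<in> J" for p
    using mult[of "- 1" p] that by auto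
  then have "subgroup J (add_monoid (poly_ring X))"
    using assms minus by (intro subgroup.intro) (auto simp: a_inv_def)
  moreover have "a * x \<in> J" if "a \<in> J" "x \<in> carrier (poly_ring X)" for a x
    using mult[OF that(2,1)] by (simp add: mult.commute)
  ultimately show ?thesis
    using mult by (intro idealI) (simp_all add: ring_axioms)
qed

text \<open>The ring \<^term>\<open>poly_ring X\<close> shares its operations with the type of all polynomials. The
  ideal properties are restated with these type class operations, so that congruences modulo \<open>J\<close>
  can be checked by algebraic simplification.\<close>

locale poly_ideal =
  fixes X :: "'v set" and J :: "'v cpoly set"
  assumes ideal_J: "ideal J (poly_ring X)"
begin

lemma subset_carrier: "p \<in> J \<Longrightarrow> p \<in> carrier (poly_ring X)"
  by (rule additive_subgroup.a_Hcarr[OF ideal.axioms(1)[OF ideal_J]])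

lemma zero_mem: "0 \<in> J"
  using additive_subgroup.zero_closed[OF ideal.axioms(1)[OF ideal_J]] by simp

lemma add_mem: "p \<in> J \<Longrightarrow> q \<in> J \<Longrightarrow> p + q \<in> J"
  using additive_subgroup.a_closed[OF ideal.axioms(1)[OF ideal_J], of p q] by simp

lemma mult_mem: "r \<in> carrier (poly_ring X) \<Longrightarrow> p \<in> J \<Longrightarrow> r * p \<in> J"
  using ideal.I_l_closed[OF ideal_J, of p r] by simp

lemma minus_mem: "p \<in> J \<Longrightarrow> - p \<in> J"
  using mult_mem[OF poly_ring_closed(5)[OF poly_ring_closed(2)], of p] by simp

lemma diff_mem: "p \<in> J \<Longrightarrow> q \<in> J \<Longrightarrow> p - q \<in> J"
  using add_mem[of p "- q"] minus_mem[of q] by simp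

lemma subspace: "module.subspace pscale J"
proof -
  interpret vector_space pscale
    by (rule vector_space_pscale)
  show ?thesis
    by (intro subspaceI zero_mem add_mem) (auto simp: pscale_def intro!: mult_mem poly_ring_closed)
qed

text \<open>The polynomials over \<open>X\<close> that represent units of the quotient ring by \<open>J\<close>.\<close>

definition unit_mod :: "'v cpoly \<Rightarrow> bool" where
  "unit_mod p \<longleftrightarrow> p \<in> carrier (poly_ring X) \<and> (\<exists>q\<in>carrier (poly_ring X). p * q - 1 \<in> J)"

lemma unit_mod_mult:
  assumes "unit_mod p" and "unit_mod q"
  shows "unit_mod (p * q)"
proof -
  obtain p' q' where *: "p' \<in> carrier (poly_ring X)" "q' \<in> carrier (poly_ring X)"
    "p * p' - 1 \<in> J" "q * q' - 1 \<in> J"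
    using assms by (auto simp: unit_mod_def)
  \<comment> \<open>this polynomial is \<open>(p * q) * (p' * q') - 1\<close>\<close>
  have "(p * p') * (q * q' - 1) + (p * p' - 1) \<in> J"
    using * assms by (intro add_mem mult_mem) (auto simp: unit_mod_def)
  then have "(p * q) * (p' * q') - 1 \<in> J"
    by (simp add: algebra_simps)
  then show ?thesis
    using * assms by (auto simp: unit_mod_def)
qed

lemma unit_mod_1: "unit_mod 1"
  using zero_mem by (auto simp: unit_mod_def intro!: bexI[of _ 1])

lemma unit_mod_power: "unit_mod p \<Longrightarrow> unit_mod (p ^ k)"
  by (induction k) (auto intro: unit_mod_1 unit_mod_mult)

lemma unit_mod_prod: "(\<And>i. i \<in> A \<Longrightarrow> unit_mod (f i)) \<Longrightarrow> unit_mod (prod f A)"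
  by (induction A rule: infinite_finite_induct) (auto intro: unit_mod_1 unit_mod_mult)

lemma unit_mod_factor:
  assumes "unit_mod (p * q)" and "p \<in> carrier (poly_ring X)" and "q \<in> carrier (poly_ring X)"
  shows "unit_mod p"
  using assms by (auto simp: unit_mod_def mult.assoc)

lemma unit_mod_cong:
  assumes "unit_mod p" and "p - q \<in> J" and "q \<in> carrier (poly_ring X)"
  shows "unit_mod q"
proof -
  obtain p' where *: "p' \<in> carrier (poly_ring X)" "p * p' - 1 \<in> J"
    using assms by (auto simp: unit_mod_def)
  \<comment> \<open>an inverse of \<open>p\<close> is an inverse of \<open>q\<close>: this polynomial is \<open>q * p' - 1\<close>\<close>
  have "(p * p' - 1) - p' * (p - q) \<in> J"
    using diff_mem[OF *(2) mult_mem[OF *(1) assms(2)]] .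
  then have "q * p' - 1 \<in> J"
    by (simp add: algebra_simps)
  then show ?thesis
    using *(1) assms(3) by (auto simp: unit_mod_def)
qed

lemma unit_mod_cancel:
  assumes "unit_mod r" and "r * p - r * q \<in> J"
    and "p \<in> carrier (poly_ring X)" and "q \<in> carrier (poly_ring X)"
  shows "p - q \<in> J"
proof -
  obtain r' where *: "r' \<in> carrier (poly_ring X)" "r * r' - 1 \<in> J"
    using assms by (auto simp: unit_mod_def)
  \<comment> \<open>this polynomial is \<open>p - q\<close>\<close>
  have "r' * (r * p - r * q) - (p - q) * (r * r' - 1) \<in> J"
    by (rule diff_mem[OF mult_mem[OF *(1) assms(2)] mult_mem[OF poly_ring_diff_closed *(2)]])
      (use assms in auto)
  then show ?thesis
    by (simp add: algebra_simps)
qed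

lemma unit_mod_pvar_of_monomial:
  assumes "finite A" and "A \<subseteq> X" and "i \<in> A" and "0 < f i"
    and "unit_mod (\<Prod>j\<in>A. pvar j ^ f j)"
  shows "unit_mod (pvar i)"
proof (rule unit_mod_factor)
  have "(\<Prod>j\<in>A. pvar j ^ f j) = pvar i ^ f i * (\<Prod>j\<in>A - {i}. pvar j ^ f j)"
    using assms by (intro prod.remove) auto
  also have "pvar i ^ f i = pvar i * pvar i ^ (f i - 1)"
    using assms(4) by (cases "f i") auto
  finally show "unit_mod (pvar i * (pvar i ^ (f i - 1) * (\<Prod>j\<in>A - {i}. pvar j ^ f j)))"
    using assms(5) by (simp add: mult.assoc)
qed (use assms in \<open>auto intro!: poly_ring_closed poly_ring_prod_closed poly_ring_power_closed\<close>)

end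

section \<open>Topplings\<close>

text \<open>The exponents of the two monomials of the toppling polynomial at \<open>i\<close>: the grains that leave
  \<open>i\<close> when it topples, and the grains that arrive at the other nonsink vertices. Loops at \<open>i\<close> are
  left out of both, so their difference is the image of \<open>i\<close> under the reduced Laplacian.\<close>

definition fire_out :: "'v set \<Rightarrow> ('v \<Rightarrow> 'v \<Rightarrow> nat) \<Rightarrow> 'v \<Rightarrow> 'v \<Rightarrow> ('v \<Rightarrow>\<^sub>0 int)" where
  "fire_out V wt s i = nat_config (V - {s}) (\<lambda>j. if j = i then outdeg V wt i - wt i i else 0)"

definition fire_in :: "'v set \<Rightarrow> ('v \<Rightarrow> 'v \<Rightarrow> nat) \<Rightarrow> 'v \<Rightarrow> 'v \<Rightarrow> ('v \<Rightarrow>\<^sub>0 int)" where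
  "fire_in V wt s i = nat_config (V - {s}) (\<lambda>j. if j = i then 0 else wt i j)"

lemma fire_nonneg:
  assumes "finite V"
  shows "fire_out V wt s i \<in> nonneg_configs (V - {s})"
    and "fire_in V wt s i \<in> nonneg_configs (V - {s})"
  using assms by (simp_all add: fire_out_def fire_in_def nat_config_nonneg)

lemma toppling_polynomial_eq:
  assumes "finite V" and "i \<in> V - {s}"
  shows "toppling_polynomial V wt s i =
    pmonom (V - {s}) (fire_out V wt s i) - pmonom (V - {s}) (fire_in V wt s i)"
proof -
  have "(\<Prod>j\<in>V - {s}. pvar j ^ (if j = i then outdeg V wt i - wt i i else 0)) =
      (pvar i ^ (outdeg V wt i - wt i i) :: 'a cpoly)"
    using assms by (subst prod.remove[of _ i]) auto
  moreover have "(\<Prod>j\<in>V - {s}. pvar j ^ (if j = i then 0 else wt i j)) =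
      (\<Prod>j\<in>V - {s} - {i}. pvar j ^ wt i j :: 'a cpoly)"
    using assms by (subst prod.remove[of _ i]) auto
  ultimately show ?thesis
    using assms by (simp add: toppling_polynomial_def fire_out_def fire_in_def pmonom_nat_config)
qed

lemma reduced_laplacian_frag_of:
  assumes "finite V" and "i \<in> V - {s}"
  shows "reduced_laplacian V wt s (frag_of i) = fire_out V wt s i - fire_in V wt s i"
proof (rule poly_mapping_eqI)
  fix j
  \<comment> \<open>so that the subtraction of natural numbers in the exponent is not truncated\<close>
  have le: "wt i i \<le> outdeg V wt i"
    unfolding outdeg_def using assms by (intro member_le_sum) auto
  have "reduced_laplacian V wt s (frag_of i) =
      frag_cmul (int (outdeg V wt i)) (frag_of i) - nat_config (V - {s}) (wt i)"
    by (simp add: reduced_laplacian_def nat_config_def)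
  then show "Poly_Mapping.lookup (reduced_laplacian V wt s (frag_of i)) j =
      Poly_Mapping.lookup (fire_out V wt s i - fire_in V wt s i) j"
    using assms le
    by (auto simp: lookup_minus lookup_nat_config fire_out_def fire_in_def of_nat_diff)
qed

lemma fire_diff_in_lattice:
  assumes "finite V" and "i \<in> V - {s}"
  shows "fire_out V wt s i - fire_in V wt s i \<in> laplacian_lattice V wt s"
  unfolding laplacian_lattice_def
  using assms by (intro image_eqI[of _ _ "frag_of i"]) (auto simp: reduced_laplacian_frag_of)

section \<open>The toppling ideal is an ideal\<close>

lemma pmonom_diff_in_toppling_ideal:
  assumes "u \<in> nonneg_configs (V - {s})" and "v \<in> nonneg_configs (V - {s})"
    and "u - v \<in> laplacian_lattice V wt s"
  shows "pmonom (V - {s}) u - pmonom (V - {s}) v \<in> toppling_ideal V wt s"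
proof -
  interpret vector_space pscale
    by (rule vector_space_pscale)
  show ?thesis
    unfolding toppling_ideal_def using assms by (intro span_base) blast
qed

text \<open>The lattice condition depends only on \<open>u - v\<close>, so the spanning set is stable under
  multiplication by monomials, and the monomials span the polynomial ring.\<close>

lemma ideal_toppling_ideal:
  assumes "finite V"
  shows "ideal (toppling_ideal V wt s) (poly_ring (V - {s}))"
proof (rule ideal_poly_ringI)
  interpret vector_space pscale
    by (rule vector_space_pscale)
  let ?X = "V - {s}" and ?I = "toppling_ideal V wt s"
  show "0 \<in> ?I"
    by (simp add: toppling_ideal_def span_zero)
  show "p + q \<in> ?I" if "p \<in> ?I" "q \<in> ?I" for p q
    using that by (simp add: toppling_ideal_def span_add)
  show "?I \<subseteq> carrier (poly_ring ?X)"
    unfolding toppling_ideal_def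
  proof (rule span_minimal)
    show "subspace (carrier (poly_ring ?X))"
      by (auto simp: subspace_def pscale_def)
  qed auto
  fix r p assume r: "r \<in> carrier (poly_ring ?X)" and p: "p \<in> ?I"
  define G where "G = {pmonom ?X u - pmonom ?X v | u v.
      u \<in> nonneg_configs ?X \<and> v \<in> nonneg_configs ?X \<and> u - v \<in> laplacian_lattice V wt s}"
  have I: "?I = span G"
    by (simp add: toppling_ideal_def G_def)
  have "span G \<subseteq> {p. r * p \<in> span G}"
  proof (rule span_minimal)
    have "r * pscale c p = pscale c (r * p)" for c and p :: "'a cpoly"
      by (simp add: pscale_def ac_simps)
    then show "subspace {p. r * p \<in> span G}"
      by (auto simp: subspace_def distrib_left span_zero span_add span_scale)
  next
    have "r * (pmonom ?X u - pmonom ?X v) \<in> span G"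
      if uv: "u \<in> nonneg_configs ?X" "v \<in> nonneg_configs ?X"
        "u - v \<in> laplacian_lattice V wt s" for u v
    proof -
      let ?x = "pmonom ?X u - pmonom ?X v"
      have "Poly_Mapping.single m c * ?x \<in> ?I" if "Poly_Mapping.keys m \<subseteq> ?X" for m c
      proof -
        let ?m = "nat_config ?X (Poly_Mapping.lookup m)"
        have m: "?m \<in> nonneg_configs ?X"
          using assms by (simp add: nat_config_nonneg)
        have "Poly_Mapping.single m c = pscale c (pmonom ?X ?m)"
          using assms that
          by (simp add: pscale_def mult_single flip: single_eq_pmonom)
        then have "Poly_Mapping.single m c * ?x =
            pscale c (pmonom ?X (?m + u) - pmonom ?X (?m + v))"
          using m uv by (simp add: pscale_def pmonom_add algebra_simps)
        moreover have "pmonom ?X (?m + u) - pmonom ?X (?m + v) \<in> ?I"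
          using m uv by (intro pmonom_diff_in_toppling_ideal nonneg_configs_add) auto
        ultimately show ?thesis
          by (simp add: I span_scale)
      qed
      then have "(\<Sum>m\<in>Poly_Mapping.keys r. Poly_Mapping.single m (Poly_Mapping.lookup r m) * ?x) \<in> ?I"
        using r unfolding I by (intro span_sum) (auto simp: poly_ring_def)
      then show ?thesis
        unfolding sum_distrib_right[symmetric] poly_sum_singles[symmetric]
        by (simp add: I)
    qed
    then show "G \<subseteq> {p. r * p \<in> span G}"
      by (auto simp: G_def)
  qed
  then show "r * p \<in> ?I"
    using p I by blast
qed

section \<open>Ideals modulo which all variables are units\<close>

context poly_ideal
begin

lemma unit_mod_pmonom:
  assumes "\<And>i. i \<in> X \<Longrightarrow> unit_mod (pvar i)"
  shows "unit_mod (pmonom X u)"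
  unfolding pmonom_def by (rule unit_mod_prod[OF unit_mod_power[OF assms]])

text \<open>Induction on a preimage \<open>c\<close> of the lattice element under the reduced Laplacian, starting from
  the vertices and closing under differences; both steps cancel a monomial. The exponents \<open>u\<close> and
  \<open>v\<close> are kept arbitrary, as the step for a difference passes through an intermediate exponent.\<close>

lemma lattice_diff_mem:
  assumes V: "finite V" and X: "X = V - {s}"
    and toppling: "\<And>i. i \<in> X \<Longrightarrow> toppling_polynomial V wt s i \<in> J"
    and unit: "\<And>i. i \<in> X \<Longrightarrow> unit_mod (pvar i)"
    and uv: "u \<in> nonneg_configs X" "v \<in> nonneg_configs X"
    and lattice: "u - v \<in> laplacian_lattice V wt s"
  shows "pmonom X u - pmonom X v \<in> J"
proof -
  have fin: "finite X"
    using V X by simp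
  obtain c where w: "u - v = reduced_laplacian V wt s c"
    and c: "c \<in> carrier (free_Abelian_group (V - {s}))"
    using lattice unfolding laplacian_lattice_def by (rule imageE)
  have keys: "Poly_Mapping.keys c \<subseteq> X"
    using c by (simp add: X)
  \<comment> \<open>the support of the lattice element is carried along for the choice of the shift \<open>m\<close> below\<close>
  from keys have "Poly_Mapping.keys (reduced_laplacian V wt s c) \<subseteq> X \<and>
    (\<forall>u\<in>nonneg_configs X. \<forall>v\<in>nonneg_configs X.
      u - v = reduced_laplacian V wt s c \<longrightarrow> pmonom X u - pmonom X v \<in> J)"
  proof (induction rule: frag_induction)
    case zero
    show ?case
      by (simp add: reduced_laplacian_def zero_mem)
  next
    case (one i)
    let ?p = "fire_out V wt s i" and ?q = "fire_in V wt s i"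
    have i: "i \<in> V - {s}"
      using one by (simp add: X)
    have pq: "?p \<in> nonneg_configs X" "?q \<in> nonneg_configs X"
      unfolding X using V by (rule fire_nonneg)+
    have t: "pmonom X ?p - pmonom X ?q \<in> J"
      using toppling[OF one] unfolding toppling_polynomial_eq[OF V i] X .
    show ?case
    proof (intro conjI ballI impI)
      show "Poly_Mapping.keys (reduced_laplacian V wt s (frag_of i)) \<subseteq> X"
        using pq keys_diff[of ?p ?q]
        unfolding reduced_laplacian_frag_of[OF V i] nonneg_configs_def by auto
    next
      fix u v assume u: "u \<in> nonneg_configs X" and v: "v \<in> nonneg_configs X"
        and "u - v = reduced_laplacian V wt s (frag_of i)"
      then have "u + ?q = v + ?p"
        unfolding reduced_laplacian_frag_of[OF V i] by (simp add: algebra_simps)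
      then have "pmonom X u * pmonom X ?q = pmonom X v * pmonom X ?p"
        using u v pq by (simp flip: pmonom_add)
      then have "pmonom X ?q * pmonom X u - pmonom X ?q * pmonom X v =
          pmonom X v * (pmonom X ?p - pmonom X ?q)"
        by (simp add: right_diff_distrib mult.commute)
      also have "\<dots> \<in> J"
        using t by (intro mult_mem) auto
      finally have mult: "pmonom X ?q * pmonom X u - pmonom X ?q * pmonom X v \<in> J" .
      show "pmonom X u - pmonom X v \<in> J"
        using unit by (intro unit_mod_cancel[OF unit_mod_pmonom mult]) auto
    qed
  next
    case (diff a b)
    have L: "reduced_laplacian V wt s (a - b) =
        reduced_laplacian V wt s a - reduced_laplacian V wt s b"
      unfolding reduced_laplacian_def by (rule frag_extend_diff)
    show ?case
    proof (intro conjI ballI impI)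
      show "Poly_Mapping.keys (reduced_laplacian V wt s (a - b)) \<subseteq> X"
        unfolding L
        by (rule order_trans[OF keys_diff Un_least[OF diff.IH(1)[THEN conjunct1]
                diff.IH(2)[THEN conjunct1]]])
    next
      fix u v assume u: "u \<in> nonneg_configs X" and v: "v \<in> nonneg_configs X"
        and eq: "u - v = reduced_laplacian V wt s (a - b)"
      let ?w = "reduced_laplacian V wt s a"
      obtain m where m: "m \<in> nonneg_configs X" "m + ?w \<in> nonneg_configs X"
        by (rule ex_nonneg_shift[OF fin diff.IH(1)[THEN conjunct1]])
      \<comment> \<open>The exponent \<open>v + m + ?w\<close> differs from \<open>v + m\<close> by the image of \<open>a\<close>, and from \<open>u + m\<close> by
        the image of \<open>b\<close>; the shift by \<open>m\<close> makes it nonnegative.\<close>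
      have "v + (m + ?w) - (v + m) = ?w"
        by simp
      with nonneg_configs_add[OF v m(2)] nonneg_configs_add[OF v m(1)]
      have a: "pmonom X (v + (m + ?w)) - pmonom X (v + m) \<in> J"
        by (rule diff.IH(1)[THEN conjunct2, rule_format])
      have "v + (m + ?w) - (u + m) = ?w - (u - v)"
        by (simp add: algebra_simps)
      also have "\<dots> = reduced_laplacian V wt s b"
        unfolding eq L by (simp add: algebra_simps)
      finally have "v + (m + ?w) - (u + m) = reduced_laplacian V wt s b" .
      with nonneg_configs_add[OF v m(2)] nonneg_configs_add[OF u m(1)]
      have b: "pmonom X (v + (m + ?w)) - pmonom X (u + m) \<in> J"
        by (rule diff.IH(2)[THEN conjunct2, rule_format])
      have "pmonom X (u + m) - pmonom X (v + m) \<in> J"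
        using diff_mem[OF a b] by simp
      then have mult: "pmonom X m * pmonom X u - pmonom X m * pmonom X v \<in> J"
        using u v m by (simp add: pmonom_add mult.commute)
      show "pmonom X u - pmonom X v \<in> J"
        using unit by (intro unit_mod_cancel[OF unit_mod_pmonom mult]) auto
    qed
  qed
  from this[THEN conjunct2, rule_format, OF uv w] show ?thesis .
qed

text \<open>The path of the burning condition is used from its start: the variable at a vertex in the
  support of \<open>b\<close> divides the unit \<open>x\<^sup>b\<close>, and along an edge from \<open>i\<close> to \<open>j \<noteq> i\<close> the variable at \<open>j\<close>
  divides the second monomial of the toppling polynomial at \<open>i\<close>, which is congruent to a power of
  the variable at \<open>i\<close>.\<close>

lemma burning_units:
  assumes G: "directed_multigraph V E wt" and b: "burning_configuration V E wt s b"
    and X: "X = V - {s}"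
    and toppling: "\<And>i. i \<in> X \<Longrightarrow> toppling_polynomial V wt s i \<in> J"
    and burn: "pmonom X b - 1 \<in> J" and "i \<in> X"
  shows "unit_mod (pvar i)"
proof -
  have V: "finite V" and wt: "\<And>u v. (u, v) \<in> E \<Longrightarrow> u \<in> V \<and> v \<in> V \<and> 0 < wt u v"
    using G by (auto simp: directed_multigraph_def)
  obtain k where k: "k \<in> Poly_Mapping.keys b" and path: "(k, i) \<in> (Restr E X)\<^sup>*"
    using b \<open>i \<in> X\<close> unfolding burning_configuration_def X by blast
  have b0: "Poly_Mapping.keys b \<subseteq> X" "\<And>v. v \<in> X \<Longrightarrow> 0 \<le> Poly_Mapping.lookup b v"
    using b X by (auto simp: burning_configuration_def nonneg_configs_def)
  have kX: "k \<in> X"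
    using b0(1) k by blast
  have k0: "0 < nat (Poly_Mapping.lookup b k)"
    using k b0(2)[OF kX] by (simp add: in_keys_iff)
  have "1 - pmonom X b \<in> J"
    using minus_mem[OF burn] by simp
  then have "unit_mod (pmonom X b)"
    by (rule unit_mod_cong[OF unit_mod_1]) auto
  then have start: "unit_mod (pvar k)"
    unfolding pmonom_def using V X kX k0
    by (intro unit_mod_pvar_of_monomial[where A = X and f = "\<lambda>i. nat (Poly_Mapping.lookup b i)"])
      auto
  from path show ?thesis
  proof (induction rule: rtrancl_induct)
    case base
    show ?case by (rule start)
  next
    case (step i j)
    show ?case
    proof (cases "j = i")
      case False
      have ij: "i \<in> X" "j \<in> X" "0 < wt i j"
        using step.hyps(2) wt by auto
      have "unit_mod (\<Prod>j\<in>X - {i}. pvar j ^ wt i j)"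
        using toppling[OF ij(1)] X
        by (intro unit_mod_cong[OF unit_mod_power[OF step.IH]])
          (auto simp: toppling_polynomial_def)
      then show ?thesis
        using V X ij False
        by (intro unit_mod_pvar_of_monomial[where A = "X - {i}" and f = "wt i"]) auto
    qed (use step.IH in simp)
  qed
qed

end

section \<open>Generators of the toppling ideal\<close>

theorem toppling_ideal_eq_genideal:
  assumes G: "directed_multigraph V E wt" and b: "burning_configuration V E wt s b"
  shows "toppling_ideal V wt s = genideal (poly_ring (V - {s}))
    (toppling_polynomial V wt s ` (V - {s}) \<union> {pmonom (V - {s}) b - 1})"
    (is "?I = genideal ?R ?S")
proof
  interpret cring ?R
    by (rule cring_poly_ring)
  let ?X = "V - {s}"
  have V: "finite V"
    using G by (simp add: directed_multigraph_def)
  have S_sub: "?S \<subseteq> ?I"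
  proof -
    have "toppling_polynomial V wt s i \<in> ?I" if "i \<in> ?X" for i
      unfolding toppling_polynomial_eq[OF V that]
      by (intro pmonom_diff_in_toppling_ideal fire_nonneg fire_diff_in_lattice V that)
    moreover
    \<comment> \<open>\<open>1\<close> is the monomial with exponent \<open>0\<close>, and \<open>b - 0\<close> lies in the lattice\<close>
    have "0 \<in> nonneg_configs ?X"
      by (simp add: nonneg_configs_def)
    then have "pmonom ?X b - pmonom ?X 0 \<in> ?I"
      using b by (intro pmonom_diff_in_toppling_ideal) (auto simp: burning_configuration_def)
    ultimately show ?thesis
      by (auto simp: pmonom_zero)
  qed
  then show "genideal ?R ?S \<subseteq> ?I"
    by (rule genideal_minimal[OF ideal_toppling_ideal[OF V]])
  have "?S \<subseteq> carrier ?R"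
    using S_sub poly_ideal.subset_carrier[OF poly_ideal.intro[OF ideal_toppling_ideal[OF V]]]
    by blast
  then have "ideal (genideal ?R ?S) ?R" and S: "?S \<subseteq> genideal ?R ?S"
    by (rule genideal_ideal, rule genideal_self)
  then interpret J: poly_ideal ?X "genideal ?R ?S"
    by (intro poly_ideal.intro)
  interpret vector_space pscale
    by (rule vector_space_pscale)
  have toppling: "toppling_polynomial V wt s i \<in> genideal ?R ?S" if "i \<in> ?X" for i
    using S that by blast
  have unit: "J.unit_mod (pvar i)" if "i \<in> ?X" for i
    using J.burning_units[OF G b refl toppling _ that] S by blast
  show "?I \<subseteq> genideal ?R ?S"
    unfolding toppling_ideal_def
    using J.lattice_diff_mem[OF V refl toppling unit]
    by (intro span_minimal J.subspace) blast
qed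

theorem proposition4p2:
  fixes n :: nat and E :: "(nat \<times> nat) set" and wt :: "nat \<Rightarrow> nat \<Rightarrow> nat"
    and b :: "nat \<Rightarrow>\<^sub>0 int"
  assumes "sandpile_graph {1..n+1} E wt (n+1)"
    and "burning_configuration {1..n+1} E wt (n+1) b"
  shows "toppling_ideal {1..n+1} wt (n+1) =
    genideal (poly_ring {1..n})
      (toppling_polynomial {1..n+1} wt (n+1) ` {1..n} \<union> {pmonom {1..n} b - 1})"
proof -
  have "{1..n+1} - {n+1} = {1..n}"
    by auto
  then show ?thesis
    using toppling_ideal_eq_genideal[of "{1..n+1}" E wt "n+1" b] assms
    by (simp add: sandpile_graph_def)
qed

end
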